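(* Let $Q$ be a quiver with two vertices $v_1,v_2$ and $a>0$ arrows from $v_1$ to $v_2$, and let $\boldsymbol b=(b_1,b_2)$ be an integer vector. Then: (1) if $a=1$, $\boldsymbol b$ is admissible for any $b_1,b_2$ (not both zero); (2) if $a=2$, $\boldsymbol b$ is admissible if and only if $b_1=-b_2\le0$ (and $\boldsymbol b\ne 0$); (3) if $a>2$, there are no admissible vectors.
   Context: $b_{ij}$ is the number of arrows $v_i\to v_j$ (negative if reversed); mutation $\mu_k$: $b'_{ij}=-b_{ij}$ if $k\in\{i,j\}$, else $b'_{ij}=b_{ij}+\mathrm{sgn}(b_{ik})[b_{ik}b_{kj}]_+$. For a quiver $Q$ on mutable vertices and an integer vector $\boldsymbol b$, add a frozen vertex $q$ with $b_i$ arrows from $v_i$ to $q$; mutations only at mutable vertices. $\boldsymbol b$ is admissible if $\boldsymbol b\neq0$ and the resulting quiver with frozen vertex has finite mutation class. *)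

theory Defs
  imports Main
begin

text \<open>A quiver without loops and oriented 2-cycles, with finite vertex set \<open>'v\<close>, is encoded by its
  exchange matrix: \<open>B i j\<close> is the number of arrows from \<open>i\<close> to \<open>j\<close>, negative if they go the other way.\<close>

definition quiver :: "('v::finite \<Rightarrow> 'v \<Rightarrow> int) \<Rightarrow> bool" where
  "quiver B \<longleftrightarrow> (\<forall>i j. B j i = - B i j)"

definition pos_part :: "int \<Rightarrow> int" where
  "pos_part x = max x 0"

definition mutate :: "'v \<Rightarrow> ('v \<Rightarrow> 'v \<Rightarrow> int) \<Rightarrow> 'v \<Rightarrow> 'v \<Rightarrow> int" where
  "mutate k B i j =
     (if k \<in> {i, j} then - B i j
      else B i j + sgn (B i k) * pos_part (B i k * B k j))"

text \<open>\<open>M\<close> is the set of mutable vertices. The class consists of labelled quivers; since there are only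
  finitely many vertices, it is finite iff it is finite up to relabelling.\<close>

inductive_set mutation_class ::
  "'v set \<Rightarrow> ('v \<Rightarrow> 'v \<Rightarrow> int) \<Rightarrow> ('v \<Rightarrow> 'v \<Rightarrow> int) set"
  for M :: "'v set" and B :: "'v \<Rightarrow> 'v \<Rightarrow> int" where
  base: "B \<in> mutation_class M B"
| step: "C \<in> mutation_class M B \<Longrightarrow> k \<in> M \<Longrightarrow> mutate k C \<in> mutation_class M B"

text \<open>The extra vertex \<open>None\<close> is the frozen one.\<close>

fun add_frozen ::
  "('v \<Rightarrow> 'v \<Rightarrow> int) \<Rightarrow> ('v \<Rightarrow> int) \<Rightarrow> 'v option \<Rightarrow> 'v option \<Rightarrow> int" where
  "add_frozen B b (Some i) (Some j) = B i j"
| "add_frozen B b (Some i) None = b i"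
| "add_frozen B b None (Some j) = - b j"
| "add_frozen B b None None = 0"

definition admissible :: "('v::finite \<Rightarrow> 'v \<Rightarrow> int) \<Rightarrow> ('v \<Rightarrow> int) \<Rightarrow> bool" where
  "admissible B b \<longleftrightarrow>
     b \<noteq> (\<lambda>_. 0) \<and> finite (mutation_class (range Some) (add_frozen B b))"

end

theory Submission
  imports Defs
begin

text \<open>After relabelling, every quiver in the mutation class has \<open>a\<close> arrows from a source \<open>s\<close> to a
  sink \<open>t\<close>. Recording \<open>p\<close> arrows from the frozen vertex to \<open>s\<close> and \<open>q\<close> arrows from \<open>t\<close> to the
  frozen vertex, mutation at the source acts by \<open>(p, q) \<mapsto> (a [p]\<^sub>+ - q, p)\<close> and mutation at the sink
  is the inverse. So the mutation class is a two-sided sequence with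
  \<open>p\<^sub>n\<^sub>+\<^sub>1 + p\<^sub>n\<^sub>-\<^sub>1 = a [p\<^sub>n]\<^sub>+\<close>. For \<open>a = 1\<close> it has period 5. For \<open>a \<ge> 2\<close> it grows strictly from any
  place where \<open>p\<^sub>n > 0\<close> and \<open>p\<^sub>n > p\<^sub>n\<^sub>-\<^sub>1\<close>, and by symmetry backwards; every nonzero sequence has such
  a place in one of the two directions, except the positive constant ones for \<open>a = 2\<close>.\<close>

section \<open>Mutations of the framed two-vertex quiver\<close>

definition kronecker :: "int \<Rightarrow> 'v \<Rightarrow> 'v \<Rightarrow> 'v \<Rightarrow> 'v \<Rightarrow> int" where
  "kronecker a s t i j = (if i = s \<and> j = t then a else if i = t \<and> j = s then - a else 0)"

definition framed_kronecker ::
  "int \<Rightarrow> 'v \<Rightarrow> 'v \<Rightarrow> int \<times> int \<Rightarrow> 'v option \<Rightarrow> 'v option \<Rightarrow> int" where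
  "framed_kronecker a s t x = add_frozen (kronecker a s t) (\<lambda>i. if i = s then - fst x else snd x)"

definition source_step :: "int \<Rightarrow> int \<times> int \<Rightarrow> int \<times> int" where
  "source_step a x = (a * pos_part (fst x) - snd x, fst x)"

definition sink_step :: "int \<Rightarrow> int \<times> int \<Rightarrow> int \<times> int" where
  "sink_step a x = (snd x, a * pos_part (snd x) - fst x)"

lemma sink_step_source_step [simp]: "sink_step a (source_step a x) = x"
  by (simp add: source_step_def sink_step_def)

lemma pos_part_mult: "a > 0 \<Longrightarrow> pos_part (a * x) = a * pos_part x"
  by (auto simp: pos_part_def max_def mult_le_0_iff zero_le_mult_iff)

text \<open>For the diagonal entries: by skew-symmetry the product along a path from a vertex to
  itself is minus a square.\<close>

lemma pos_part_uminus_square: "pos_part (- (x * x)) = 0"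
  by (simp add: pos_part_def)

text \<open>Lets the sign factor of the mutation rule be dropped in front of
  \<open>pos_part x\<close>.\<close>

lemma pos_part_eq_0_or_sgn_eq_1: "pos_part x = 0 \<or> sgn x = 1"
  by (auto simp: pos_part_def sgn_if)

lemma mutate_source:
  assumes "s \<noteq> t" "(UNIV :: 'v set) = {s, t}" "a > 0"
  shows "mutate (Some s) (framed_kronecker a s t x) =
    framed_kronecker a t (s :: 'v) (source_step a x)"
proof (intro ext)
  fix i j :: "'v option"
  have two: "v = s \<or> v = t" for v using assms(2) by auto
  have i: "i = None \<or> i = Some s \<or> i = Some t" using two by (cases i) auto
  have j: "j = None \<or> j = Some s \<or> j = Some t" using two by (cases j) auto
  show "mutate (Some s) (framed_kronecker a s t x) i j =
      framed_kronecker a t s (source_step a x) i j"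
    using i j assms(1,3)
    by (elim disjE) (simp_all add: mutate_def framed_kronecker_def kronecker_def source_step_def
        pos_part_eq_0_or_sgn_eq_1 pos_part_mult pos_part_uminus_square
        mult.commute mult.left_commute)
qed

lemma mutate_sink:
  assumes "s \<noteq> t" "(UNIV :: 'v set) = {s, t}" "a > 0"
  shows "mutate (Some t) (framed_kronecker a s t x) =
    framed_kronecker a t (s :: 'v) (sink_step a x)"
proof (intro ext)
  fix i j :: "'v option"
  have two: "v = s \<or> v = t" for v using assms(2) by auto
  have i: "i = None \<or> i = Some s \<or> i = Some t" using two by (cases i) auto
  have j: "j = None \<or> j = Some s \<or> j = Some t" using two by (cases j) auto
  show "mutate (Some t) (framed_kronecker a s t x) i j =
      framed_kronecker a t s (sink_step a x) i j"
    using i j assms(1,3)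
    by (elim disjE) (simp_all add: mutate_def framed_kronecker_def kronecker_def sink_step_def
        pos_part_eq_0_or_sgn_eq_1 pos_part_mult pos_part_uminus_square
        mult.commute mult.left_commute)
qed

section \<open>Reduction to finite sets of integer pairs\<close>

definition step_closed :: "int \<Rightarrow> (int \<times> int) set \<Rightarrow> bool" where
  "step_closed a P \<longleftrightarrow> (\<forall>x\<in>P. source_step a x \<in> P \<and> sink_step a x \<in> P)"

lemma finite_mutation_class_iff:
  fixes s t :: "'v::finite"
  assumes "s \<noteq> t" "(UNIV :: 'v set) = {s, t}" "a > 0"
  shows "finite (mutation_class (range Some) (framed_kronecker a s t x)) \<longleftrightarrow>
    (\<exists>P. finite P \<and> step_closed a P \<and> x \<in> P)" (is "finite ?M \<longleftrightarrow> _")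
proof -
  have two: "v = s \<or> v = t" for v using assms(2) by auto
  show ?thesis
  proof
    assume fin: "finite ?M"
    \<comment> \<open>Both orientations are collected, since every mutation exchanges source and
      sink.\<close>
    define P where "P = {y. \<exists>u v. u \<noteq> v \<and> framed_kronecker a u v y \<in> ?M}"
    have "P \<subseteq> (\<lambda>(C, u, v). (C None (Some u), C (Some v) None)) ` (?M \<times> UNIV \<times> UNIV)"
    proof
      fix y assume "y \<in> P"
      then obtain u v where "u \<noteq> v" "framed_kronecker a u v y \<in> ?M"
        unfolding P_def by blast
      then show "y \<in> (\<lambda>(C, u, v). (C None (Some u), C (Some v) None)) ` (?M \<times> UNIV \<times> UNIV)"
        by (intro image_eqI[where x = "(framed_kronecker a u v y, u, v)"])
          (auto simp: framed_kronecker_def)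
    qed
    then have "finite P"
      by (rule finite_subset) (use fin in simp)
    moreover have "step_closed a P"
      unfolding step_closed_def
    proof
      fix y assume "y \<in> P"
      then obtain u v where uv: "u \<noteq> v" and y: "framed_kronecker a u v y \<in> ?M"
        unfolding P_def by blast
      have U: "(UNIV :: 'v set) = {u, v}" using uv two[of u] two[of v] assms(2) by auto
      have "framed_kronecker a v u (source_step a y) \<in> ?M"
        "framed_kronecker a v u (sink_step a y) \<in> ?M"
        using mutation_class.step[OF y rangeI, of u] mutation_class.step[OF y rangeI, of v]
        unfolding mutate_source[OF uv U assms(3)] mutate_sink[OF uv U assms(3)] by auto
      with not_sym[OF uv] show "source_step a y \<in> P \<and> sink_step a y \<in> P"
        unfolding P_def by blast
    qed
    moreover have "x \<in> P"
      using assms(1) mutation_class.base unfolding P_def by blast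
    ultimately show "\<exists>P. finite P \<and> step_closed a P \<and> x \<in> P" by blast
  next
    assume "\<exists>P. finite P \<and> step_closed a P \<and> x \<in> P"
    then obtain P where P: "finite P" "step_closed a P" "x \<in> P" by blast
    have "\<exists>u v y. u \<noteq> v \<and> y \<in> P \<and> C = framed_kronecker a u v y" if "C \<in> ?M" for C
      using that
    proof induction
      case base
      then show ?case using assms(1) P(3) by blast
    next
      case (step C k)
      then obtain u v y where uv: "u \<noteq> v" and y: "y \<in> P" and C: "C = framed_kronecker a u v y"
        by blast
      have U: "(UNIV :: 'v set) = {u, v}" using uv two[of u] two[of v] assms(2) by auto
      have "k = Some u \<or> k = Some v" using step.hyps(2) U by auto
      then show ?case
        using mutate_source[OF uv U assms(3)] mutate_sink[OF uv U assms(3)] uv y P(2)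
        unfolding step_closed_def C by metis
    qed
    then have "?M \<subseteq> (\<Union>u. \<Union>v. framed_kronecker a u v ` P)"
      by blast
    then show "finite ?M"
      by (rule finite_subset) (use P(1) in simp)
  qed
qed

lemma step_closed_swap: "step_closed a P \<Longrightarrow> step_closed a (prod.swap ` P)"
proof -
  \<comment> \<open>Exchanging the coordinates is time reversal: it conjugates each step into the
    other.\<close>
  have "source_step a (prod.swap x) = prod.swap (sink_step a x)"
    "sink_step a (prod.swap x) = prod.swap (source_step a x)" for x
    by (simp_all add: source_step_def sink_step_def)
  then show "step_closed a P \<Longrightarrow> step_closed a (prod.swap ` P)"
    by (auto simp: step_closed_def)
qed

text \<open>If \<open>p > q\<close> and \<open>p > 0\<close>, the next entry satisfies
  \<open>a * p - q \<ge> 2 * p - q > p\<close>, so the first coordinates grow without bound.\<close>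

lemma infinite_if_increasing:
  assumes "step_closed a P" "a \<ge> 2" "(p, q) \<in> P" "p > 0" "p > q"
  shows "infinite P"
proof
  assume fin: "finite P"
  have "\<exists>p' q'. (p', q') \<in> P \<and> p' > q' \<and> p' > int n" for n
  proof (induction n)
    case 0
    then show ?case using assms by auto
  next
    case (Suc n)
    then obtain p' q' where pq: "(p', q') \<in> P" "p' > q'" "p' > int n" by blast
    have "(a * p' - q', p') \<in> P"
      using assms(1) pq unfolding step_closed_def source_step_def pos_part_def by fastforce
    moreover have "a * p' \<ge> 2 * p'"
      using assms(2) pq(3) by (intro mult_right_mono) auto
    ultimately show ?case
      using pq(2,3) by (smt (verit) of_nat_Suc)
  qed
  \<comment> \<open>If the maximum is negative, \<open>nat\<close> truncates it to 0, which is still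
    an upper bound.\<close>
  from this[of "nat (Max (fst ` P))"] obtain p' q'
    where "(p', q') \<in> P" "p' > int (nat (Max (fst ` P)))"
    by blast
  moreover from this have "p' \<le> Max (fst ` P)"
    using fin by (intro Max_ge) force+
  ultimately show False by linarith
qed

lemma infinite_if_neq:
  assumes "step_closed a P" "a \<ge> 2" "(p, q) \<in> P" "p > 0 \<or> q > 0" "p \<noteq> q"
  shows "infinite P"
proof (cases "p > q")
  case True
  with assms show ?thesis by (intro infinite_if_increasing[of a P p q]) auto
next
  case False
  with assms have "infinite (prod.swap ` P)"
    by (intro infinite_if_increasing[of a _ q p] step_closed_swap) force+
  then show ?thesis by blast
qed

lemma infinite_step_closed:
  assumes P: "step_closed a P" and a: "a \<ge> 2" and pq: "(p, q) \<in> P"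
    and nz: "(p, q) \<noteq> (0, 0)" and const: "\<not> (a = 2 \<and> p = q \<and> p \<ge> 0)"
  shows "infinite P"
proof -
  have closed: "(a * pos_part u - v, u) \<in> P" if "(u, v) \<in> P" for u v
    using P that unfolding step_closed_def source_step_def by force
  consider "p > 0 \<or> q > 0" "p \<noteq> q" | "p = q" "p > 0" | "p < 0" "q \<le> 0" | "p = 0" "q < 0"
    using nz by force
  then show ?thesis
  proof cases
    case 1
    then show ?thesis using infinite_if_neq[OF P a pq] by blast
  next
    case 2
    \<comment> \<open>One step leads to \<open>(a * p - p, p)\<close>, and for
      \<open>a \<ge> 3\<close> its first coordinate is at least \<open>2 * p\<close>, hence larger
      than \<open>p\<close>.\<close>
    then have "a \<ge> 3" using a const by auto
    then have "a * p \<ge> 3 * p" using 2 by (intro mult_right_mono) auto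
    then show ?thesis
      using infinite_if_neq[OF P a closed[OF pq]] 2 by (auto simp: pos_part_def)
  next
    case 3
    \<comment> \<open>After two steps the first coordinate is at least \<open>- 2 * q - p\<close>,
      which exceeds \<open>- q \<ge> 0\<close> because \<open>q \<le> 0\<close> and
      \<open>p < 0\<close>.\<close>
    have "(- q, p) \<in> P" using closed[OF pq] 3 by (simp add: pos_part_def)
    then have "(a * pos_part (- q) - p, - q) \<in> P" by (rule closed)
    moreover have "a * pos_part (- q) \<ge> 2 * (- q)"
      using mult_right_mono[OF a, of "- q"] 3 by (simp add: pos_part_def)
    ultimately show ?thesis
      using infinite_if_neq[OF P a] 3 by (smt (verit))
  next
    case 4
    have "(- q, 0) \<in> P" using closed[OF pq] 4 by (simp add: pos_part_def)
    then show ?thesis using infinite_if_neq[OF P a] 4 by force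
  qed
qed

text \<open>This is the tropical form of the pentagon recurrence of type A2; it is checked by
  splitting on the signs at each step.\<close>

lemma source_step_1_period:
  "source_step 1 (source_step 1 (source_step 1 (source_step 1 (source_step 1 x)))) = x"
  by (cases x) (auto simp: source_step_def pos_part_def max_def)

lemma finite_step_closed_1: "\<exists>P. finite P \<and> step_closed 1 P \<and> x \<in> P"
proof -
  let ?f = "source_step 1"
  \<comment> \<open>By the period 5, the inverse step is the fourth power of the forward one, so the
    forward orbit is closed under both.\<close>
  have "sink_step 1 x = ?f (?f (?f (?f x)))"
    using sink_step_source_step[of 1 "?f (?f (?f (?f x)))"] by (simp add: source_step_1_period)
  then show ?thesis
    by (intro exI[of _ "{x, ?f x, ?f (?f x), ?f (?f (?f x)), ?f (?f (?f (?f x)))}"])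
      (simp add: step_closed_def source_step_1_period)
qed

lemma finite_step_closed_iff:
  assumes "a \<ge> 2" "x \<noteq> (0, 0)"
  shows "(\<exists>P. finite P \<and> step_closed a P \<and> x \<in> P) \<longleftrightarrow> a = 2 \<and> fst x = snd x \<and> fst x \<ge> 0"
proof
  assume "\<exists>P. finite P \<and> step_closed a P \<and> x \<in> P"
  then show "a = 2 \<and> fst x = snd x \<and> fst x \<ge> 0"
    using infinite_step_closed[OF _ assms(1)] assms(2) by (metis prod.collapse)
next
  assume "a = 2 \<and> fst x = snd x \<and> fst x \<ge> 0"
  \<comment> \<open>A nonnegative constant pair is fixed by both steps, as
    \<open>2 * p - p = p\<close>.\<close>
  then have "step_closed a {x}"
    by (cases x) (simp add: step_closed_def source_step_def sink_step_def pos_part_def)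
  then show "\<exists>P. finite P \<and> step_closed a P \<and> x \<in> P" by blast
qed

lemma admissible_iff_finite_step_closed:
  fixes B :: "'v::finite \<Rightarrow> 'v \<Rightarrow> int"
  assumes "quiver B" "v1 \<noteq> v2" "(UNIV :: 'v set) = {v1, v2}" "a > 0" "B v1 v2 = a"
  shows "admissible B b \<longleftrightarrow> \<not> (b v1 = 0 \<and> b v2 = 0) \<and>
    (\<exists>P. finite P \<and> step_closed a P \<and> (- b v1, b v2) \<in> P)"
proof -
  have two: "v = v1 \<or> v = v2" for v using assms(3) by auto
  have skew: "B j i = - B i j" for i j using assms(1) unfolding quiver_def by blast
  have diag: "B i i = 0" for i using skew[of i i] by linarith
  have "B i j = kronecker a v1 v2 i j" for i j
    using two[of i] two[of j] skew[of v1 v2] diag assms(2,5) by (auto simp: kronecker_def)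
  then have B: "B = kronecker a v1 v2" by blast
  have b: "b = (\<lambda>i. if i = v1 then - fst (- b v1, b v2) else snd (- b v1, b v2))"
    using two by fastforce
  have "add_frozen B b = framed_kronecker a v1 v2 (- b v1, b v2)"
    unfolding framed_kronecker_def B using b by (rule arg_cong)
  moreover have "b \<noteq> (\<lambda>_. 0) \<longleftrightarrow> \<not> (b v1 = 0 \<and> b v2 = 0)"
    using two by (metis (full_types))
  ultimately show ?thesis
    by (simp add: admissible_def finite_mutation_class_iff[OF assms(2-4)])
qed

theorem theorem7p1:
  fixes B :: "'v::finite \<Rightarrow> 'v \<Rightarrow> int" and v1 v2 :: 'v and a :: nat
  assumes "quiver B"
    and "v1 \<noteq> v2" and "(UNIV :: 'v set) = {v1, v2}"
    and "a > 0" and "B v1 v2 = int a"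
  shows "(a = 1 \<longrightarrow>
            (\<forall>b. \<not> (b v1 = 0 \<and> b v2 = 0) \<longrightarrow> admissible B b)) \<and>
         (a = 2 \<longrightarrow>
            (\<forall>b. admissible B b \<longleftrightarrow>
                 b v1 = - b v2 \<and> b v1 \<le> 0 \<and> \<not> (b v1 = 0 \<and> b v2 = 0))) \<and>
         (a > 2 \<longrightarrow> (\<nexists>b. admissible B b))"
proof -
  have adm: "admissible B b \<longleftrightarrow> \<not> (b v1 = 0 \<and> b v2 = 0) \<and>
      (\<exists>P. finite P \<and> step_closed (int a) P \<and> (- b v1, b v2) \<in> P)" for b
    using admissible_iff_finite_step_closed[OF assms(1-3) _ assms(5)] assms(4) by simp
  \<comment> \<open>This treats \<open>a = 2\<close> and \<open>a > 2\<close> together; the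
    condition of a nonnegative constant pair turns into \<open>b v1 = - b v2\<close> and
    \<open>b v1 \<le> 0\<close>.\<close>
  have adm2: "admissible B b \<longleftrightarrow> \<not> (b v1 = 0 \<and> b v2 = 0) \<and>
      a = 2 \<and> b v1 = - b v2 \<and> b v1 \<le> 0" if "a \<ge> 2" for b
    using finite_step_closed_iff[of "int a" "(- b v1, b v2)"] that adm[of b] by auto
  show ?thesis
  proof (intro conjI impI allI)
    fix b :: "'v \<Rightarrow> int" assume "a = 1" "\<not> (b v1 = 0 \<and> b v2 = 0)"
    then show "admissible B b" using adm[of b] finite_step_closed_1 by simp
  next
    fix b :: "'v \<Rightarrow> int" assume "a = 2"
    then show "admissible B b \<longleftrightarrow> b v1 = - b v2 \<and> b v1 \<le> 0 \<and> \<not> (b v1 = 0 \<and> b v2 = 0)"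
      using adm2[of b] by blast
  next
    assume "a > 2"
    then show "\<nexists>b. admissible B b" using adm2 by simp
  qed
qed

end
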